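(* Let $G=(V,E)$ be a connected graph and let $M\in\mathcal{M}(G)$ be a matrix with $\operatorname{corank}(M)=2$. Then $M$ satisfies the Strong Arnold Property (SAP).
   Context: Graphs are finite, simple and undirected. For a graph $G=(V,E)$, $\mathcal{M}(G)$ denotes the set of all real symmetric matrices $M\in\mathbb{R}^{V\times V}$ such that (i) $M_{uv}<0$ whenever $uv\in E$, and $M_{uv}=0$ whenever $uv\notin E$ and $u\neq v$; (ii) $M$ has exactly one negative eigenvalue (counted with multiplicity). There is no condition on the diagonal of $M$. $\operatorname{corank}(M)=\dim\ker(M)$. A matrix $M\in\mathcal{M}(G)$ satisfies the Strong Arnold Property (SAP) if there is no non-zero symmetric matrix $X\in\mathbb{R}^{V\times V}$ such that $MX=\mathbf{0}$ and $X_{uv}=0$ whenever $uv\in E$ or $u=v$. *)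

theory Defs
  imports
    "Graph_Theory.Pair_Digraph"
    "Graph_Theory.Digraph_Component"
    "HOL-Analysis.Analysis"
    "HOL-Computational_Algebra.Polynomial"
begin

text \<open>
  A finite simple undirected graph is a \<^locale>\<open>pair_graph\<close>: every edge \<open>uv\<close> is represented by
  both pairs \<open>(u, v)\<close> and \<open>(v, u)\<close>. Matrices are indexed by a finite type, so for a graph
  with vertex set \<open>UNIV\<close> the type \<open>real ^ 'v ^ 'v\<close> is the space of real \<open>V \<times> V\<close> matrices.
\<close>

definition charpoly :: "'a::comm_ring_1 ^ 'n ^ 'n \<Rightarrow> 'a poly" where
  "charpoly A = det (mat [:0, 1:] - map_matrix (\<lambda>a. [:a:]) A)"

text \<open>
  The characteristic polynomial is monic, so \<^const>\<open>proots\<close> is the multiset of the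
  eigenvalues lying in the base ring, each with its algebraic multiplicity. For a real symmetric
  matrix these are all the eigenvalues.
\<close>

definition eigenvalues_mset :: "'a::idom ^ 'n ^ 'n \<Rightarrow> 'a multiset" where
  "eigenvalues_mset A = proots (charpoly A)"

definition corank :: "real ^ 'n ^ 'm \<Rightarrow> nat" where
  "corank A = dim {x. A *v x = 0}"

definition graph_matrices :: "('v::finite) pair_pre_digraph \<Rightarrow> (real ^ 'v ^ 'v) set" where
  "graph_matrices G = {M. transpose M = M
     \<and> (\<forall>u v. (u, v) \<in> parcs G \<longrightarrow> M $ u $ v < 0)
     \<and> (\<forall>u v. (u, v) \<notin> parcs G \<and> u \<noteq> v \<longrightarrow> M $ u $ v = 0)
     \<and> size {#a \<in># eigenvalues_mset M. a < 0#} = 1}"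

definition strong_arnold_property :: "('v::finite) pair_pre_digraph \<Rightarrow> real ^ 'v ^ 'v \<Rightarrow> bool" where
  "strong_arnold_property G M \<longleftrightarrow>
     \<not> (\<exists>X :: real ^ 'v ^ 'v. X \<noteq> 0 \<and> transpose X = X \<and> M ** X = 0
          \<and> (\<forall>u v. (u, v) \<in> parcs G \<or> u = v \<longrightarrow> X $ u $ v = 0))"

end

theory Submission
  imports Defs
begin

text \<open>
  Let \<open>X\<close> be a non-zero symmetric matrix with \<open>M X = 0\<close> that vanishes on the diagonal and on the
  edges; the task is to derive a contradiction. Pick \<open>u\<close>, \<open>v\<close> with \<open>c = X\<^sub>u\<^sub>v \<noteq> 0\<close> and let \<open>x\<close>, \<open>y\<close> be
  the rows of \<open>X\<close> at \<open>u\<close> and \<open>v\<close>. Both lie in the kernel of \<open>M\<close>. Because the diagonal of \<open>X\<close>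
  vanishes, the pairs \<open>(x\<^sub>u, x\<^sub>v) = (0, c)\<close> and \<open>(y\<^sub>u, y\<^sub>v) = (c, 0)\<close> show that \<open>x\<close>, \<open>y\<close> are independent,
  so they span the two-dimensional kernel. Expressing every row of \<open>X\<close> in this basis gives
  \<open>c X\<^sub>w\<^sub>k = y\<^sub>w x\<^sub>k + x\<^sub>w y\<^sub>k\<close>. The zero diagonal of \<open>X\<close> now says that \<open>x\<close> and \<open>y\<close> have disjoint
  supports, and the zeros on the edges say that no edge joins these supports.

  Such a kernel basis cannot exist, by \<open>kernel_no_separated_basis\<close>. A non-negative kernel vector of a
  connected graph has no zero entry unless it is \<open>0\<close>, so \<open>x\<close> and \<open>y\<close>, which do have zeros, take both
  signs. Let \<open>q(z) = z \<bullet> M z\<close>. The positive parts satisfy \<open>q(x\<^sup>+) \<le> 0\<close> and \<open>q(y\<^sup>+) \<le> 0\<close>, since off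
  the diagonal \<open>M\<close> is non-positive, and \<open>x\<^sup>+\<close>, \<open>y\<^sup>+\<close> are orthogonal for \<open>q\<close>, since they are
  separated. Hence \<open>q \<le> 0\<close> on the plane of \<open>x\<^sup>+\<close> and \<open>y\<^sup>+\<close>. As \<open>M\<close> has only one negative eigenvalue,
  \<open>q\<close> is positive semidefinite on some hyperplane and vanishes there only on the kernel
  (\<open>one_negative_eigenvalue_complement\<close>). The plane meets the hyperplane, so some non-trivial
  combination of \<open>x\<^sup>+\<close> and \<open>y\<^sup>+\<close> is a kernel vector, that is, a combination of \<open>x\<close> and \<open>y\<close>.
  Comparing entries at vertices where \<open>x\<close> or \<open>y\<close> is negative, and then where it is positive, shows
  that all coefficients are \<open>0\<close>.

  Since eigenvalues are counted as roots of the characteristic polynomial, the hyperplane property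
  needs a link between eigenvectors and algebraic multiplicity. Two independent eigenvectors give two
  roots, equal or not (\<open>left_eigenvectors_subset_eigenvalues\<close>), so it is enough to minimise the
  Rayleigh quotient twice: first on the whole space, then on the orthogonal complement of the first
  minimiser.
\<close>

section \<open>Minima of the Rayleigh quotient\<close>

text \<open>
  First-order condition for the minimum of \<open>x \<bullet> M x - c (x \<bullet> x)\<close> on \<open>S\<close>: the gradient at \<open>z\<close> is
  twice \<open>w = M z - c z\<close>. Invariance of \<open>S\<close> makes \<open>w\<close> itself an admissible direction, along which
  the form would decrease below its minimum if \<open>w\<close> were not \<open>0\<close>.
\<close>

lemma rayleigh_minimizer_eigenvector:
  fixes M :: "real ^ 'n ^ 'n"
  assumes sym: "transpose M = M"
    and S: "subspace S" "\<And>x. x \<in> S \<Longrightarrow> M *v x \<in> S"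
    and bound: "\<And>x. x \<in> S \<Longrightarrow> c * (x \<bullet> x) \<le> x \<bullet> (M *v x)"
    and z: "z \<in> S" "z \<bullet> (M *v z) = c * (z \<bullet> z)"
  shows "M *v z = c *\<^sub>R z"
proof -
  define w where "w = M *v z - c *\<^sub>R z"
  define W where "W = w \<bullet> w"
  define K where "K = w \<bullet> (M *v w) - c * (w \<bullet> w)"
  have wS: "w \<in> S"
    unfolding w_def using S z by (intro subspace_diff subspace_scale) auto
  have adj: "z \<bullet> (M *v w) = (M *v z) \<bullet> w"
    by (metis dot_lmul_matrix sym vector_transpose_matrix)
  have W: "z \<bullet> (M *v w) = W + c * (z \<bullet> w)" "w \<bullet> (M *v z) = W + c * (z \<bullet> w)"
  proof -
    have "W = w \<bullet> (M *v z - c *\<^sub>R z)" by (simp add: W_def w_def)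
    then show "w \<bullet> (M *v z) = W + c * (z \<bullet> w)"
      by (simp add: inner_diff_right inner_commute)
    then show "z \<bullet> (M *v w) = W + c * (z \<bullet> w)"
      by (simp add: adj inner_commute)
  qed
  have "0 \<le> 2 * t * W + t\<^sup>2 * K" for t
  proof -
    have "z + t *\<^sub>R w \<in> S"
      using S z wS by (intro subspace_add subspace_scale)
    from bound[OF this] show ?thesis
      unfolding K_def
      by (simp add: matrix_vector_right_distrib matrix_vector_mult_scaleR inner_add_left inner_add_right
        inner_commute[of w z] z(2) W algebra_simps power2_eq_square)
  qed
  \<comment> \<open>The step \<open>- W / (K + 1)\<close> is small enough for the linear term to dominate, also when \<open>K = 0\<close>.\<close>
  note pos = this[of "- W / (K + 1)"]
  have K: "K \<ge> 0" using bound[OF wS] by (simp add: K_def)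
  have "2 * (- W / (K + 1)) * W + (- W / (K + 1))\<^sup>2 * K = - (W\<^sup>2 * (K + 2)) / (K + 1)\<^sup>2"
    using K by (simp add: divide_simps power2_eq_square) (simp add: algebra_simps)
  with pos have "W\<^sup>2 * (K + 2) / (K + 1)\<^sup>2 \<le> 0" by simp
  with K have "W\<^sup>2 * (K + 2) \<le> 0" by (simp add: divide_le_0_iff)
  with K have "W = 0"
    by (simp add: mult_le_0_iff)
  then show ?thesis by (simp add: W_def w_def)
qed

text \<open>
  The minimum of \<open>x \<bullet> M x\<close> over the compact unit sphere of \<open>S\<close> is the least eigenvalue of \<open>M\<close> on \<open>S\<close>.
\<close>

lemma rayleigh_minimum_exists:
  fixes M :: "real ^ 'n ^ 'n"
  assumes sym: "transpose M = M"
    and S: "subspace S" "\<And>x. x \<in> S \<Longrightarrow> M *v x \<in> S" and ne: "S \<noteq> {0}"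
  obtains c p where "p \<in> S" "p \<noteq> 0" "M *v p = c *\<^sub>R p"
    "\<And>x. x \<in> S \<Longrightarrow> c * (x \<bullet> x) \<le> x \<bullet> (M *v x)"
proof -
  obtain y where y: "y \<in> S" "y \<noteq> 0" using ne subspace_0[OF S(1)] by blast
  have "compact (S \<inter> sphere 0 1)"
    by (intro closed_Int_compact closed_subspace S compact_sphere)
  moreover have "(1 / norm y) *\<^sub>R y \<in> S \<inter> sphere 0 1"
    using y S by (auto intro: subspace_scale)
  moreover have "continuous_on (S \<inter> sphere 0 1) (\<lambda>x. x \<bullet> (M *v x))"
    by (intro continuous_intros matrix_vector_mult_linear_continuous_on)
  ultimately obtain p where p: "p \<in> S \<inter> sphere 0 1"
    and min: "\<And>x. x \<in> S \<inter> sphere 0 1 \<Longrightarrow> p \<bullet> (M *v p) \<le> x \<bullet> (M *v x)"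
    by (metis (no_types, lifting) continuous_attains_inf empty_iff)
  define c where "c = p \<bullet> (M *v p)"
  have bound: "c * (x \<bullet> x) \<le> x \<bullet> (M *v x)" if "x \<in> S" for x
  proof (cases "x = 0")
    case False
    have "(1 / norm x) *\<^sub>R x \<in> S \<inter> sphere 0 1"
      using that False S by (auto intro: subspace_scale)
    from min[OF this] have "c \<le> (x \<bullet> (M *v x)) / (norm x)\<^sup>2"
      by (simp add: c_def matrix_vector_mult_scaleR power2_eq_square)
    with False show ?thesis
      by (simp add: power2_norm_eq_inner pos_le_divide_eq)
  qed simp
  have "p \<bullet> p = 1" using p by (simp add: dot_square_norm)
  then have "M *v p = c *\<^sub>R p"
    using p by (intro rayleigh_minimizer_eigenvector[OF sym S bound]) (auto simp: c_def)
  with p bound show ?thesis by (intro that[of p c]) auto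
qed

section \<open>Eigenvectors and algebraic multiplicity\<close>

lemma det_map_matrix_const_poly:
  "det (map_matrix (\<lambda>a. [:a:]) A) = [:det (A :: 'a::comm_ring_1 ^ 'n ^ 'n):]"
proof -
  have prod: "(\<Prod>i\<in>I. [:f i:]) = [:\<Prod>i\<in>I. f i:]" for I and f :: "'n \<Rightarrow> 'a"
    by (induction I rule: infinite_finite_induct) (auto simp: one_pCons)
  have sum: "(\<Sum>i\<in>I. [:f i:]) = [:\<Sum>i\<in>I. f i:]" for I and f :: "('n \<Rightarrow> 'n) \<Rightarrow> 'a"
    by (induction I rule: infinite_finite_induct) auto
  show ?thesis
    by (simp add: det_def prod flip: sum) (simp add: of_int_poly mult.commute)
qed

text \<open>
  The non-zero minor makes the two row vectors independent, and it also provides an explicit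
  invertible \<open>P\<close> having them among its rows: replace rows \<open>i\<close> and \<open>j\<close> of the identity. In the
  product of \<open>P\<close> with \<open>t I - A\<close> these two rows are multiplied by \<open>t - a\<close> and \<open>t - b\<close>. Pulling both
  factors out of the determinant shows that \<open>(t - a) (t - b)\<close> divides the characteristic polynomial,
  also when \<open>a = b\<close>, where the roots alone would not reveal the multiplicity.
\<close>

lemma left_eigenvectors_subset_eigenvalues:
  fixes A :: "'a::field ^ 'n ^ 'n"
  assumes p: "p v* A = a *s p" and r: "r v* A = b *s r"
    and minor: "p $ i * r $ j \<noteq> p $ j * r $ i"
    and nz: "charpoly A \<noteq> 0"
  shows "{#a, b#} \<subseteq># eigenvalues_mset A"
proof -
  have ij: "i \<noteq> j" using minor by auto
  define P where "P = (\<chi> k. if k = i then p else if k = j then r else axis k 1)"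
  define Q where "Q = map_matrix (\<lambda>a. [:a:]) P"
  define N where "N = mat [:0, 1:] - map_matrix (\<lambda>a. [:a:]) A"
  have "z = 0" if z: "P *v z = 0" for z
  proof -
    have row: "(\<Sum>l\<in>UNIV. P $ k $ l * z $ l) = 0" for k
      using arg_cong[OF z, of "\<lambda>v. v $ k"] by (simp add: matrix_vector_mult_def)
    have zk: "z $ k = 0" if "k \<noteq> i" "k \<noteq> j" for k
      using row[of k] that by (simp add: P_def axis_def if_distrib[of "\<lambda>t. t * _"] cong: if_cong)
    have two: "(\<Sum>l\<in>UNIV. f l * z $ l) = f i * z $ i + f j * z $ j" for f
    proof -
      have "(\<Sum>l\<in>UNIV. f l * z $ l) = (\<Sum>l\<in>{i,j}. f l * z $ l)"
        by (rule sum.mono_neutral_right) (auto simp: zk)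
      then show ?thesis using ij by simp
    qed
    have 1: "p $ i * z $ i + p $ j * z $ j = 0" and 2: "r $ i * z $ i + r $ j * z $ j = 0"
      using row[of i] row[of j] ij unfolding two by (simp_all add: P_def)
    have "(p $ i * r $ j - p $ j * r $ i) * z $ i = 0" "(p $ i * r $ j - p $ j * r $ i) * z $ j = 0"
      using 1 2 by algebra+
    with minor have "z $ i = 0" "z $ j = 0" by auto
    with zk show "z = 0" by (metis vec_eq_iff zero_index)
  qed
  then have "invertible P"
    unfolding invertible_left_inverse matrix_left_invertible_ker by blast
  then have detP: "det P \<noteq> 0" by (simp add: invertible_det_nz)
  \<comment> \<open>\<open>R\<close> is what remains of \<open>Q ** N\<close> once the linear factors \<open>D k\<close> are taken out of its rows.\<close>
  define D where "D k = (if k = i then [:-a, 1:] else if k = j then [:-b, 1:] else 1)" for k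
  define R where "R = (\<chi> k. if k = i \<or> k = j then Q $ k else (Q ** N) $ k)"
  have eig: "(Q ** N) $ k = [:-e, 1:] *s Q $ k" if "P $ k v* A = e *s P $ k" for k e
  proof -
    have "(\<Sum>m\<in>UNIV. [:P $ k $ m:] * [:A $ m $ l:]) = [:e * P $ k $ l:]" for l
    proof -
      have "(\<Sum>m\<in>UNIV. [:P $ k $ m:] * [:A $ m $ l:]) = [:\<Sum>m\<in>UNIV. P $ k $ m * A $ m $ l:]"
        by (induction rule: infinite_finite_induct) auto
      also have "(\<Sum>m\<in>UNIV. P $ k $ m * A $ m $ l) = e * P $ k $ l"
        using arg_cong[OF that, of "\<lambda>v. v $ l"] by (simp add: vector_matrix_mult_def mult.commute)
      finally show ?thesis .
    qed
    moreover have "(\<Sum>m\<in>UNIV. [:P $ k $ m:] * mat [:0, 1:] $ m $ l) = [:P $ k $ l:] * [:0, 1:]" for l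
      by (simp add: mat_def if_distrib[of "\<lambda>t. _ * t"] cong: if_cong)
    ultimately show ?thesis
      by (simp add: vec_eq_iff matrix_matrix_mult_def Q_def N_def right_diff_distrib
          sum_subtractf map_matrix_def)
  qed
  have "(Q ** N) = (\<chi> k. D k *s R $ k)"
    using eig[of i a] eig[of j b] ij p r
    by (subst vec_eq_iff) (auto simp: D_def R_def P_def)
  then have "det Q * det N = (\<Prod>k\<in>UNIV. D k) * det R"
    using det_rows_mul[of D "\<lambda>k. R $ k"] by (simp add: det_mul[symmetric])
  moreover have "(\<Prod>k\<in>UNIV. D k) = (\<Prod>k\<in>{i,j}. D k)"
    by (rule prod.mono_neutral_right) (auto simp: D_def)
  moreover have "det Q = [:det P:]" by (simp add: Q_def det_map_matrix_const_poly)
  moreover have "det N = charpoly A" by (simp add: N_def charpoly_def)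
  ultimately have *: "smult (det P) (charpoly A) = [:-a, 1:] * [:-b, 1:] * det R"
    using ij by (simp add: D_def)
  with nz detP have "det R \<noteq> 0" by auto
  then have "proots ([:-a, 1:] * [:-b, 1:] * det R) = {#a, b#} + proots (det R)"
    by (simp add: proots_mult del: mult_pCons_left mult_pCons_right)
  moreover have "eigenvalues_mset A = proots (smult (det P) (charpoly A))"
    using detP by (simp add: eigenvalues_mset_def)
  ultimately have "eigenvalues_mset A = {#a, b#} + proots (det R)"
    by (simp only: *)
  then show ?thesis by simp
qed

text \<open>
  The normal vector \<open>p\<close> of the hyperplane is an eigenvector for the least eigenvalue \<open>a\<close>. Let \<open>b\<close> be
  the least eigenvalue on the orthogonal complement of \<open>p\<close>. If \<open>b\<close> were negative, then \<open>a \<le> b < 0\<close>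
  would be two negative roots of the characteristic polynomial. So the form is non-negative on the
  complement, and a \<open>z\<close> where it is not positive is a minimiser with value \<open>0\<close>, hence in the kernel.
\<close>

lemma one_negative_eigenvalue_complement:
  fixes M :: "real ^ 'n ^ 'n"
  assumes sym: "transpose M = M"
    and one: "size {#a \<in># eigenvalues_mset M. a < 0#} = 1"
  obtains p where "\<And>z. p \<bullet> z = 0 \<Longrightarrow> z \<bullet> (M *v z) \<le> 0 \<Longrightarrow> M *v z = 0"
proof -
  have adj: "(M *v x) \<bullet> y = x \<bullet> (M *v y)" for x y
    by (metis dot_lmul_matrix sym vector_transpose_matrix)
  \<comment> \<open>The zero polynomial has no roots in the multiset sense, so it is excluded by \<open>one\<close>.\<close>
  have nz: "charpoly M \<noteq> 0"
    using one by (auto simp: eigenvalues_mset_def)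
  have "(UNIV :: (real ^ 'n) set) \<noteq> {0}"
    by (metis UNIV_I axis_eq_0_iff singletonD zero_neq_one)
  then obtain a p where p: "p \<noteq> 0" "M *v p = a *\<^sub>R p"
    and a: "\<And>x. a * (x \<bullet> x) \<le> x \<bullet> (M *v x)"
    using rayleigh_minimum_exists[OF sym subspace_UNIV UNIV_I] by (metis UNIV_I)
  define S where "S = {z. p \<bullet> z = 0}"
  have S: "subspace S" "\<And>x. x \<in> S \<Longrightarrow> M *v x \<in> S"
    by (auto simp: S_def subspace_hyperplane p simp flip: adj)
  have nonneg: "0 \<le> x \<bullet> (M *v x)" if "x \<in> S" for x
  proof (cases "S = {0}")
    case False
    then obtain b r where r: "r \<in> S" "r \<noteq> 0" "M *v r = b *\<^sub>R r"
      and b: "\<And>x. x \<in> S \<Longrightarrow> b * (x \<bullet> x) \<le> x \<bullet> (M *v x)"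
      using rayleigh_minimum_exists[OF sym S False] by metis
    have "b \<ge> 0"
    proof (rule ccontr)
      assume "\<not> b \<ge> 0"
      then have "b < 0" by simp
      have "a * (r \<bullet> r) \<le> b * (r \<bullet> r)" using a[of r] r by simp
      then have "a < 0" using r \<open>b < 0\<close> by (simp add: mult_le_cancel_right)
      \<comment> \<open>Orthogonal non-zero vectors are not proportional, so some minor of them does not vanish.\<close>
      obtain i where i: "p $ i \<noteq> 0" using p by (auto simp: vec_eq_iff)
      have "\<exists>j. p $ i * r $ j \<noteq> p $ j * r $ i"
      proof (rule ccontr)
        assume "\<not> ?thesis"
        then have *: "p $ i *\<^sub>R r = r $ i *\<^sub>R p" by (simp add: vec_eq_iff mult.commute)
        then have "p \<bullet> (r $ i *\<^sub>R p) = 0"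
          using r(1) unfolding *[symmetric] by (simp add: S_def)
        with p have "r $ i = 0" by simp
        with * i r show False by simp
      qed
      then obtain j where "p $ i * r $ j \<noteq> p $ j * r $ i" by blast
      moreover have "p v* M = a *s p" "r v* M = b *s r"
        using p r by (metis scalar_mult_eq_scaleR sym vector_transpose_matrix)+
      ultimately have "{#a, b#} \<subseteq># eigenvalues_mset M"
        by (intro left_eigenvectors_subset_eigenvalues[OF _ _ _ nz])
      then have "filter_mset (\<lambda>e. e < 0) {#a, b#} \<subseteq># {#e \<in># eigenvalues_mset M. e < 0#}"
        by (rule multiset_filter_mono)
      from size_mset_mono[OF this] show False
        using one \<open>a < 0\<close> \<open>b < 0\<close> by simp
    qed
    with b[OF that] show ?thesis
      by (meson inner_ge_zero mult_nonneg_nonneg order_trans)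
  qed (use that in auto)
  show ?thesis
  proof (rule that)
    fix z assume z: "p \<bullet> z = 0" "z \<bullet> (M *v z) \<le> 0"
    then have "z \<in> S" by (simp add: S_def)
    with z nonneg[of z] have "M *v z = 0 *\<^sub>R z"
      by (intro rayleigh_minimizer_eigenvector[OF sym S]) (auto simp: nonneg intro: antisym)
    then show "M *v z = 0" by simp
  qed
qed

section \<open>Kernel vectors of matrices of connected graphs\<close>

lemma connected_arc_closed_set:
  fixes G :: "'v pair_pre_digraph"
  assumes "pair_graph G" and "pverts G = UNIV"
    and conn: "Digraph_Component.connected (with_proj G)"
    and v: "v \<in> A" and closed: "\<And>u w. u \<in> A \<Longrightarrow> (u, w) \<in> parcs G \<Longrightarrow> w \<in> A"
  shows "w \<in> A"
proof -
  interpret pair_graph G by fact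
  have "symmetric G"
    by (rule sym_arcs)
  with conn have "v \<rightarrow>\<^sup>*\<^bsub>with_proj G\<^esub> w"
    using symmetric_connected_imp_strongly_connected assms(2) by (auto elim: strongly_connectedE)
  then show "w \<in> A"
    by (induction rule: reachable_induct) (auto intro: v closed)
qed

definition pos_part :: "real ^ 'n \<Rightarrow> real ^ 'n" where
  "pos_part x = (\<chi> v. max 0 (x $ v))"

lemma pos_part_nth [simp]: "pos_part x $ v = max 0 (x $ v)"
  by (simp add: pos_part_def)

lemma form_expand:
  fixes M :: "real ^ 'n ^ 'n"
  shows "x \<bullet> (M *v y) = (\<Sum>u\<in>UNIV. \<Sum>v\<in>UNIV. x $ u * (M $ u $ v * y $ v))"
  by (simp add: inner_vec_def matrix_vector_mult_def sum_distrib_left)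

locale graph_matrix =
  fixes G :: "('v::finite) pair_pre_digraph" and M :: "real ^ 'v ^ 'v"
  assumes graph: "pair_graph G"
    and verts: "pverts G = UNIV"
    and connected_graph: "Digraph_Component.connected (with_proj G)"
    and M: "M \<in> graph_matrices G"
begin

lemma symmetric: "transpose M = M"
  and arc_neg: "(u, v) \<in> parcs G \<Longrightarrow> M $ u $ v < 0"
  and nonarc_zero: "(u, v) \<notin> parcs G \<Longrightarrow> u \<noteq> v \<Longrightarrow> M $ u $ v = 0"
  and one_negative: "size {#a \<in># eigenvalues_mset M. a < 0#} = 1"
  using M by (auto simp: graph_matrices_def)

lemma offdiag_nonpos: "u \<noteq> v \<Longrightarrow> M $ u $ v \<le> 0"
  using arc_neg[of u v] nonarc_zero[of u v] by fastforce

text \<open>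
  A discrete minimum principle. If \<open>x\<^sub>u = 0\<close>, then row \<open>u\<close> of \<open>M x = 0\<close> is a vanishing sum of
  non-positive terms, so \<open>x\<close> is \<open>0\<close> at all neighbours of \<open>u\<close> too; by connectedness a single
  zero would spread to all vertices.
\<close>

lemma nonneg_kernel_vector_positive:
  assumes ker: "M *v x = 0" and nonneg: "\<And>v. 0 \<le> x $ v" and "x \<noteq> 0"
  shows "0 < x $ w"
proof (rule ccontr)
  assume "\<not> 0 < x $ w"
  with nonneg[of w] have "w \<in> {v. x $ v = 0}" by simp
  have "v \<in> {v. x $ v = 0}" for v
  proof (rule connected_arc_closed_set[OF graph verts connected_graph \<open>w \<in> _\<close>])
    fix u v assume "u \<in> {v. x $ v = 0}" and arc: "(u, v) \<in> parcs G"
    then have xu: "x $ u = 0" by simp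
    have "(\<Sum>k\<in>UNIV. - M $ u $ k * x $ k) = 0"
      using arg_cong[OF ker, of "\<lambda>y. y $ u"] by (simp add: matrix_vector_mult_def sum_negf)
    moreover have "0 \<le> - M $ u $ k * x $ k" for k
      using offdiag_nonpos[of u k] nonneg[of k] xu by (cases "k = u") (auto simp: mult_nonpos_nonneg)
    ultimately have "- M $ u $ v * x $ v = 0"
      by (subst (asm) sum_nonneg_eq_0_iff) auto
    with arc_neg[OF arc] show "v \<in> {v. x $ v = 0}" by simp
  qed
  with \<open>x \<noteq> 0\<close> show False by (simp add: vec_eq_iff)
qed

lemma kernel_vector_with_zero_has_pos_entry:
  assumes ker: "M *v z = 0" and "z \<noteq> 0" and "z $ w = 0"
  obtains v where "z $ v > 0"
proof (rule ccontr)
  assume "\<not> thesis"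
  with that have "0 \<le> (- z) $ v" for v by (metis le_minus_iff minus_zero not_less vector_uminus_component)
  moreover have "M *v (- z) = 0" using ker by (simp add: vec.neg)
  ultimately have "0 < (- z) $ w"
    using \<open>z \<noteq> 0\<close> by (intro nonneg_kernel_vector_positive) auto
  with \<open>z $ w = 0\<close> show False by simp
qed

text \<open>
  Write \<open>x = x\<^sup>+ - x\<^sup>-\<close>. On the kernel \<open>M x\<^sup>+ = M x\<^sup>-\<close>, which turns the form into \<open>x\<^sup>+ \<bullet> M x\<^sup>-\<close>. As \<open>x\<^sup>+\<close>
  and \<open>x\<^sup>-\<close> have disjoint supports, the diagonal of \<open>M\<close>, whose signs are unknown, does not enter.
\<close>

lemma kernel_pos_part_form_nonpos:
  assumes "M *v x = 0"
  shows "pos_part x \<bullet> (M *v pos_part x) \<le> 0"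
proof -
  have "pos_part x = x + pos_part (- x)" by (simp add: vec_eq_iff max_def)
  then have "M *v pos_part x = M *v pos_part (- x)"
    using assms by (metis add_0 matrix_vector_right_distrib)
  also have "pos_part x \<bullet> \<dots> \<le> 0"
    unfolding form_expand
  proof (intro sum_nonpos)
    fix u v
    show "pos_part x $ u * (M $ u $ v * pos_part (- x) $ v) \<le> 0"
      using offdiag_nonpos[of u v]
      by (cases "u = v") (auto simp: max_def mult_nonneg_nonpos mult_nonpos_nonneg)
  qed
  finally show ?thesis .
qed

text \<open>
  Disjoint supports force zeros in both vectors, so each takes both signs. The positive parts span a
  plane on which the form is non-positive; it must meet the hyperplane of
  \<open>one_negative_eigenvalue_complement\<close>, and thus contain a kernel vector \<open>z \<noteq> 0\<close>. But a combination
  of \<open>x\<close> and \<open>y\<close> that vanishes wherever \<open>x\<close> or \<open>y\<close> is negative is \<open>0\<close>.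
\<close>

lemma kernel_no_separated_basis:
  assumes span: "{z. M *v z = 0} \<subseteq> span {x, y}"
    and ker: "M *v x = 0" "M *v y = 0"
    and ne: "x \<noteq> 0" "y \<noteq> 0"
    and disj: "\<And>v. x $ v * y $ v = 0"
    and sep: "\<And>u v. (u, v) \<in> parcs G \<Longrightarrow> x $ u * y $ v = 0"
  shows False
proof -
  obtain v0 where "y $ v0 \<noteq> 0" using ne by (auto simp: vec_eq_iff)
  with disj have "x $ v0 = 0" by (metis mult_eq_0_iff)
  obtain u0 where "x $ u0 \<noteq> 0" using ne by (auto simp: vec_eq_iff)
  with disj have "y $ u0 = 0" by (metis mult_eq_0_iff)
  obtain xp where "x $ xp > 0"
    using kernel_vector_with_zero_has_pos_entry[OF ker(1) ne(1) \<open>x $ v0 = 0\<close>] .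
  moreover obtain xn where "x $ xn < 0"
    using kernel_vector_with_zero_has_pos_entry[of "- x" v0] ker ne \<open>x $ v0 = 0\<close>
    by (auto simp: vec.neg)
  moreover obtain yp where "y $ yp > 0"
    using kernel_vector_with_zero_has_pos_entry[OF ker(2) ne(2) \<open>y $ u0 = 0\<close>] .
  moreover obtain yn where "y $ yn < 0"
    using kernel_vector_with_zero_has_pos_entry[of "- y" u0] ker ne \<open>y $ u0 = 0\<close>
    by (auto simp: vec.neg)
  ultimately have sgn: "x $ xp > 0" "x $ xn < 0" "y $ yp > 0" "y $ yn < 0" by simp_all
  have orth: "pos_part x \<bullet> (M *v pos_part y) = 0"
    unfolding form_expand
  proof (intro sum.neutral ballI)
    fix u v
    have "x $ u = 0 \<or> y $ v = 0 \<or> M $ u $ v = 0"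
      using disj[of u] sep[of u v] nonarc_zero[of u v] by auto
    then show "pos_part x $ u * (M $ u $ v * pos_part y $ v) = 0" by auto
  qed
  have orth': "pos_part y \<bullet> (M *v pos_part x) = 0"
    by (metis orth dot_lmul_matrix inner_commute symmetric vector_transpose_matrix)
  obtain p where p: "\<And>z. p \<bullet> z = 0 \<Longrightarrow> z \<bullet> (M *v z) \<le> 0 \<Longrightarrow> M *v z = 0"
    using one_negative_eigenvalue_complement[OF symmetric one_negative] by blast
  \<comment> \<open>A non-trivial combination of the positive parts that lies in the hyperplane orthogonal to \<open>p\<close>.\<close>
  obtain s t where st: "s \<noteq> 0 \<or> t \<noteq> 0" "s * (p \<bullet> pos_part x) + t * (p \<bullet> pos_part y) = 0"
  proof (cases "p \<bullet> pos_part x = 0")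
    case True
    then show ?thesis by (intro that[of 1 0]) auto
  next
    case False
    then show ?thesis by (intro that[of "p \<bullet> pos_part y" "- (p \<bullet> pos_part x)"]) auto
  qed
  define z where "z = s *\<^sub>R pos_part x + t *\<^sub>R pos_part y"
  have "z \<bullet> (M *v z) = s\<^sup>2 * (pos_part x \<bullet> (M *v pos_part x)) + t\<^sup>2 * (pos_part y \<bullet> (M *v pos_part y))"
    by (simp add: z_def matrix_vector_right_distrib matrix_vector_mult_scaleR inner_add_left
        inner_add_right orth orth' power2_eq_square)
  also have "\<dots> \<le> 0"
    using kernel_pos_part_form_nonpos ker by (intro add_nonpos_nonpos mult_nonneg_nonpos) auto
  finally have "M *v z = 0"
    using st by (intro p) (auto simp: z_def inner_add_right)
  then obtain a b where z: "z = a *\<^sub>R x + b *\<^sub>R y"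
    using span by (fastforce simp: span_insert span_singleton diff_eq_eq add.commute)
  have coord: "s * max 0 (x $ v) + t * max 0 (y $ v) = a * x $ v + b * y $ v" for v
    using arg_cong[OF z, of "\<lambda>z. z $ v"] by (simp add: z_def)
  have "y $ xp = 0" "y $ xn = 0" "x $ yp = 0" "x $ yn = 0"
    using disj[of xp] disj[of xn] disj[of yp] disj[of yn] sgn by auto
  \<comment> \<open>At \<open>xn\<close> only the term with \<open>a\<close> survives, so \<open>a = 0\<close>; then \<open>xp\<close> gives \<open>s = 0\<close>. Likewise for \<open>b\<close> and \<open>t\<close>.\<close>
  then have "s = 0" "t = 0"
    using coord[of xp] coord[of xn] coord[of yp] coord[of yn] sgn by auto
  with st show False by simp
qed

end

section \<open>The Strong Arnold Property\<close>

theorem proposition3: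
  fixes G :: "('v::finite) pair_pre_digraph"
    and M :: "real ^ 'v ^ 'v"
  assumes "pair_graph G"
    and "pverts G = UNIV"
    and "Digraph_Component.connected (with_proj G)"
    and "M \<in> graph_matrices G"
    and "corank M = 2"
  shows "strong_arnold_property G M"
  unfolding strong_arnold_property_def
proof
  interpret graph_matrix G M using assms(1-4) by (rule graph_matrix.intro)
  let ?K = "{z. M *v z = 0}"
  assume "\<exists>X :: real ^ 'v ^ 'v. X \<noteq> 0 \<and> transpose X = X \<and> M ** X = 0
          \<and> (\<forall>u v. (u, v) \<in> parcs G \<or> u = v \<longrightarrow> X $ u $ v = 0)"
  then obtain X :: "real ^ 'v ^ 'v" where "X \<noteq> 0" and symX: "transpose X = X" and MX: "M ** X = 0"
    and diag: "\<And>v. X $ v $ v = 0" and arc: "\<And>u v. (u, v) \<in> parcs G \<Longrightarrow> X $ u $ v = 0"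
    by blast
  have comm: "X $ u $ v = X $ v $ u" for u v
    by (metis symX transpose_def vec_lambda_beta)
  have ker: "M *v (X $ w) = 0" for w
  proof -
    have "(M *v (X $ w)) $ u = (M ** X) $ u $ w" for u
      by (simp add: matrix_vector_mult_def matrix_matrix_mult_def comm[of w])
    then show ?thesis by (simp add: vec_eq_iff MX)
  qed
  obtain u v where c: "X $ u $ v \<noteq> 0" using \<open>X \<noteq> 0\<close> by (auto simp: vec_eq_iff)
  define x where "x = X $ u"
  define y where "y = X $ v"
  define c where "c = X $ u $ v"
  have xy: "x $ u = 0" "x $ v = c" "y $ u = c" "y $ v = 0" "c \<noteq> 0"
    using c diag comm[of v u] by (auto simp: x_def y_def c_def)
  have "x \<noteq> y" using xy by auto
  have "x \<notin> span {y}" "y \<noteq> 0"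
    using xy by (auto simp: span_singleton)
  then have "independent {x, y}"
    using \<open>x \<noteq> y\<close> by (simp add: independent_insert)
  have span: "?K \<subseteq> span {x, y}"
    using \<open>independent {x, y}\<close> \<open>x \<noteq> y\<close> assms(5) ker
    by (intro card_ge_dim_independent) (auto simp: corank_def x_def y_def)
  have form: "c * X $ w $ k = X $ w $ v * x $ k + X $ w $ u * y $ k" for w k
  proof -
    have "X $ w \<in> span {x, y}" using span ker by blast
    then obtain a b where *: "X $ w = a *\<^sub>R x + b *\<^sub>R y"
      by (fastforce simp: span_insert span_singleton diff_eq_eq add.commute)
    \<comment> \<open>The entries at \<open>v\<close> and \<open>u\<close> read off the coordinates in the basis \<open>x\<close>, \<open>y\<close>.\<close>
    have "X $ w $ v = a * c" "X $ w $ u = b * c" using xy by (simp_all add: *)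
    then show ?thesis by (simp add: * algebra_simps)
  qed
  then have form: "c * X $ w $ k = y $ w * x $ k + x $ w * y $ k" for w k
    by (simp add: x_def y_def comm[of w u] comm[of w v])
  have disj: "x $ w * y $ w = 0" for w
    using form[of w w] diag[of w] by simp
  have "x $ w * y $ k = 0" if "(w, k) \<in> parcs G" for w k
    using form[of w k] arc[OF that] disj[of w] disj[of k] by auto
  with disj span ker xy show False
    by (intro kernel_no_separated_basis[of x y]) (auto simp: x_def y_def)
qed

end
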